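(* Let $U$ be a pruned tree on $\omega$ and let $c:[U]\to(0;1)$ be continuous. Then there is a continuous function $\mathcal{H}_c:\mathrm{PrTr}_2\to\mathbf{K}$ such that for every $T\in\mathrm{PrTr}_2$: if $T\in\mathrm{WF}_2$ then $\mathcal{H}_c(T)$ is spongy, and if $T\in\mathrm{IF}_2$ then $\operatorname{ran}\mathcal{D}_{\mathcal{H}_c(T)}=\operatorname{ran}(c)\cup\{0,1\}$.
   Context: $2^{\omega}$ is the Cantor space; $N_s=\{x\in2^\omega:s\subset x\}$; $\mu$ is the coin-tossing measure, $\mu(N_s)=2^{-\mathrm{lh}(s)}$. For measurable $A$, $\mathcal{D}_A(z)=\lim_n\mu(A\cap N_{z\restriction n})/\mu(N_{z\restriction n})$ when it exists; $\operatorname{ran}\mathcal{D}_A$ is the set of values attained where defined. $A$ is spongy if there is some $z$ at which $\mathcal{D}_A(z)$ does not exist, while at every $z$ where it exists its value lies in $\{0,1\}$. A pruned tree on a set $I$ is a nonempty set of finite sequences from $I$ closed under initial segments in which every node has a proper extension; $[U]$ is its set of infinite branches with the product topology. $\mathrm{PrTr}_2$ is the Polish space of pruned trees on $\{0,1\}$ (subspace of $2^{(2^{<\omega})}$). $\mathcal{N}=\{y\in2^\omega:y(n)=1\text{ for infinitely many }n\}$; $\mathrm{WF}_2=\{T\in\mathrm{PrTr}_2:[T]\cap\mathcal{N}=\emptyset\}$, $\mathrm{IF}_2=\{T\in\mathrm{PrTr}_2:[T]\cap\mathcal{N}\ne\emptyset\}$. $\mathbf{K}$ is the space of compact subsets of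 $2^\omega$ with the Vietoris topology. *)

theory Defs
  imports "HOL-Probability.Probability"
begin

definition cantor_top :: "(nat \<Rightarrow> bool) topology" where
  "cantor_top = product_topology (\<lambda>_. discrete_topology UNIV) UNIV"

definition restr :: "(nat \<Rightarrow> 'a) \<Rightarrow> nat \<Rightarrow> 'a list" where
  "restr z n = map z [0..<n]"

definition Nbhd :: "bool list \<Rightarrow> (nat \<Rightarrow> bool) set" where
  "Nbhd s = {x. \<forall>i<length s. x i = s ! i}"

definition coin :: "(nat \<Rightarrow> bool) measure" where
  "coin = PiM UNIV (\<lambda>_. measure_pmf (bernoulli_pmf (1/2)))"

definition dens_seq :: "(nat \<Rightarrow> bool) set \<Rightarrow> (nat \<Rightarrow> bool) \<Rightarrow> nat \<Rightarrow> real" where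
  "dens_seq A z n = measure coin (A \<inter> Nbhd (restr z n)) / measure coin (Nbhd (restr z n))"

definition dens_exists :: "(nat \<Rightarrow> bool) set \<Rightarrow> (nat \<Rightarrow> bool) \<Rightarrow> bool" where
  "dens_exists A z \<longleftrightarrow> convergent (dens_seq A z)"

definition dens :: "(nat \<Rightarrow> bool) set \<Rightarrow> (nat \<Rightarrow> bool) \<Rightarrow> real" where
  "dens A z = lim (dens_seq A z)"

definition ran_dens :: "(nat \<Rightarrow> bool) set \<Rightarrow> real set" where
  "ran_dens A = {dens A z | z. dens_exists A z}"

definition spongy :: "(nat \<Rightarrow> bool) set \<Rightarrow> bool" where
  "spongy A \<longleftrightarrow> (\<exists>z. \<not> dens_exists A z) \<and> (\<forall>z. dens_exists A z \<longrightarrow> dens A z \<in> {0, 1})"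

definition pruned_tree :: "'a list set \<Rightarrow> bool" where
  "pruned_tree U \<longleftrightarrow> U \<noteq> {} \<and> (\<forall>s\<in>U. \<forall>n. take n s \<in> U)
      \<and> (\<forall>s\<in>U. \<exists>t\<in>U. length s < length t \<and> take (length s) t = s)"

definition body :: "'a list set \<Rightarrow> (nat \<Rightarrow> 'a) set" where
  "body U = {x. \<forall>n. restr x n \<in> U}"

definition baire_top :: "(nat \<Rightarrow> nat) topology" where
  "baire_top = product_topology (\<lambda>_. discrete_topology UNIV) UNIV"

text \<open>Trees on {0,1} as characteristic functions bool list => bool, i.e. points of
  2^(2^<omega) with the product topology; PrTr_2 is the subspace of pruned trees.\<close>
definition PrTr2 :: "(bool list \<Rightarrow> bool) set" where
  "PrTr2 = {T. pruned_tree (Collect T)}"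

definition PrTr2_top :: "(bool list \<Rightarrow> bool) topology" where
  "PrTr2_top = subtopology (product_topology (\<lambda>_. discrete_topology UNIV) UNIV) PrTr2"

definition infOnes :: "(nat \<Rightarrow> bool) set" where
  "infOnes = {y. infinite {n. y n}}"

definition WF2 :: "(bool list \<Rightarrow> bool) set" where
  "WF2 = {T \<in> PrTr2. body (Collect T) \<inter> infOnes = {}}"

definition IF2 :: "(bool list \<Rightarrow> bool) set" where
  "IF2 = {T \<in> PrTr2. body (Collect T) \<inter> infOnes \<noteq> {}}"

definition Kspace :: "(nat \<Rightarrow> bool) set set" where
  "Kspace = {K. compactin cantor_top K}"

definition vietoris_top :: "(nat \<Rightarrow> bool) set topology" where
  "vietoris_top = subtopology
     (topology_generated_by
        ({{K. K \<subseteq> V} | V. openin cantor_top V} \<union> {{K. K \<inter> V \<noteq> {}} | V. openin cantor_top V}))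
     Kspace"

end

theory Submission
  imports Defs
begin

text \<open>
  Every tree \<open>T\<close> is assigned a martingale on the binary tree with values in \<open>[0, 1]\<close>, and
  \<open>\<H>\<^sub>c(T)\<close> is the set of points along which it stays positive. Since every node has a descendant
  three levels further where the martingale is already 0 or 1, a contraction argument shows that the
  density of that set in a basic neighbourhood is exactly the value of the martingale there, so
  everything reduces to the limits of the martingale along points.

  A point encodes, as long as it is active, a branch \<open>y\<close> of \<open>T\<close> together with a branch
  \<open>x\<close> of \<open>U\<close>, of which one more entry is read with every 1 in \<open>y\<close>. Along it the martingale is
  steered alternately towards two values which depend only on the part \<open>u\<close> of \<open>x\<close> read so far,
  differ by a positive amount, and both tend to \<open>c(x)\<close> as \<open>u\<close> grows. If \<open>y\<close> has infinitely many
  ones, the martingale tends to \<open>c(x)\<close>; otherwise it oscillates forever. At a point that has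
  stopped being active, the martingale is that of a lexicographic initial segment, whose only
  possible limits are 0 and 1.
\<close>

section \<open>Histories and cylinders\<close>

text \<open>Finite initial segments are kept in reverse, so that extending them is \<open>Cons\<close>.\<close>

definition hist :: "(nat \<Rightarrow> 'a) \<Rightarrow> nat \<Rightarrow> 'a list" where
  "hist z n = rev (restr z n)"

lemma hist_0 [simp]: "hist z 0 = []"
  and hist_Suc [simp]: "hist z (Suc n) = z n # hist z n"
  and length_hist [simp]: "length (hist z n) = n"
  by (simp_all add: hist_def restr_def)

lemma hist_eq_iff: "hist x n = hist y n \<longleftrightarrow> (\<forall>i<n. x i = y i)"
  by (induction n) (auto simp: less_Suc_eq)

lemma restr_eq_iff: "restr x n = restr y n \<longleftrightarrow> (\<forall>i<n. x i = y i)"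
  using hist_eq_iff[of x n y] by (simp add: hist_def)

lemma length_restr [simp]: "length (restr x n) = n"
  by (simp add: restr_def)

lemma take_restr: "m \<le> n \<Longrightarrow> take m (restr x n) = restr x m"
  by (simp add: restr_def take_map take_upt)

text \<open>Taking the whole history as the state turns this course-of-values recursion into a
  primitive one.\<close>

lemma stream_of_rule: "\<exists>z. \<forall>n. z n = g (hist z n)"
proof -
  define R where "R = rec_nat [] (\<lambda>_ r. g r # r)"
  define z where "z n = g (R n)" for n
  have "hist z n = R n" for n
    by (induction n) (simp_all add: R_def z_def)
  then show ?thesis
    by (intro exI[of _ z]) (simp add: z_def)
qed

lemma stream_extending:
  obtains z :: "nat \<Rightarrow> 'a"
  where "hist z (length r) = r" "\<And>n. length r \<le> n \<Longrightarrow> z n = f (hist z n)"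
proof -
  obtain z where z: "\<forall>n. z n = (if n < length r then rev r ! n else f (hist z n))"
    using stream_of_rule[of "\<lambda>h. if length h < length r then rev r ! length h else f h",
        unfolded length_hist] by blast
  have "map z [0..<length r] = rev r"
    by (rule nth_equalityI) (auto simp: z)
  then have "hist z (length r) = r"
    by (simp add: hist_def restr_def)
  then show thesis
    by (rule that) (simp add: z)
qed

definition cyl :: "bool list \<Rightarrow> (nat \<Rightarrow> bool) set" where
  "cyl r = {z. hist z (length r) = r}"

lemma Nbhd_restr: "Nbhd (restr z n) = cyl (hist z n)"
  by (auto simp: Nbhd_def cyl_def hist_eq_iff restr_def)

lemma cyl_hist: "cyl (hist z n) = {x. \<forall>i<n. x i = z i}"
  by (auto simp: cyl_def hist_eq_iff)

lemma mem_cyl_hist [simp]: "z \<in> cyl (hist z n)"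
  by (simp add: cyl_def)

lemma cyl_split: "cyl r = cyl (True # r) \<union> cyl (False # r)"
  and cyl_disjoint: "cyl (True # r) \<inter> cyl (False # r) = {}"
  by (auto simp: cyl_def)

lemma space_coin [simp]: "space coin = UNIV"
  by (simp add: coin_def space_PiM)

lemma prob_space_coin: "prob_space coin"
  unfolding coin_def by (intro prob_space_PiM prob_space_measure_pmf)

lemma cyl_measurable [measurable]: "cyl r \<in> sets coin"
  and measure_cyl: "measure coin (cyl r) = 1 / 2 ^ length r"
proof -
  let ?M = "\<lambda>_::nat. measure_pmf (bernoulli_pmf (1/2))"
  interpret P: product_prob_space ?M UNIV
    by unfold_locales
  let ?X = "\<Pi>\<^sub>E i\<in>{..<length r}. {rev r ! i}"
  have "cyl r = {z. \<forall>i<length r. z i = rev r ! i}"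
  proof -
    obtain x :: "nat \<Rightarrow> bool" where x: "hist x (length r) = r"
      by (rule stream_extending[of r "\<lambda>_. True"])
    then have "rev r = restr x (length r)"
      by (metis hist_def rev_rev_ident)
    then have "rev r ! i = x i" if "i < length r" for i
      using that by (simp add: restr_def)
    then show ?thesis
      using cyl_hist[of x "length r"] x by auto
  qed
  also have "\<dots> = prod_emb UNIV ?M {..<length r} ?X"
    unfolding prod_emb_def by (rule set_eqI) (simp add: PiE_iff Ball_def)
  finally have eq: "cyl r = prod_emb UNIV ?M {..<length r} ?X" .
  show "cyl r \<in> sets coin"
    unfolding eq coin_def by (rule sets_PiM_I) auto
  have "measure coin (cyl r) = (\<Prod>i<length r. measure (?M i) {rev r ! i})"
    unfolding eq coin_def by (rule P.measure_PiM_emb) auto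
  also have "\<dots> = (\<Prod>i<length r. 1/2)"
    by (rule prod.cong) (auto simp: measure_pmf_single pmf_bernoulli_half)
  finally show "measure coin (cyl r) = 1 / 2 ^ length r"
    by (simp add: power_one_over)
qed

section \<open>Martingales and their supports\<close>

text \<open>Going up from the zero at \<open>w @ r\<close>, each averaging pairs the bound reached
  so far with the trivial bound \<open>B\<close> for the sibling, so the gain over \<open>B\<close>
  is halved per level but never lost. The induction removes the last bit of \<open>w\<close>, which
  is the one next to \<open>r\<close> in reversed order.\<close>

lemma average_zero_bound:
  fixes g :: "bool list \<Rightarrow> real"
  assumes avg: "\<And>r. g (True # r) + g (False # r) = 2 * g r"
    and bound: "\<And>r. \<bar>g r\<bar> \<le> B"
    and "g (w @ r) = 0"
  shows "\<bar>g r\<bar> \<le> (1 - 1 / 2 ^ length w) * B"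
  using assms(3)
proof (induction w arbitrary: r rule: rev_induct)
  case (snoc b w)
  have 1: "\<bar>g (b # r)\<bar> \<le> (1 - 1 / 2 ^ length w) * B"
    using snoc by simp
  have 2: "\<bar>g ((\<not> b) # r)\<bar> \<le> B"
    by (rule bound)
  have "2 * g r = g (b # r) + g ((\<not> b) # r)"
    using avg[of r] by (cases b) auto
  then have "2 * \<bar>g r\<bar> \<le> (1 - 1 / 2 ^ length w) * B + B"
    using 1 2 by linarith
  then show ?case
    by (simp add: field_simps)
qed simp

locale decided_martingale =
  fixes d :: "bool list \<Rightarrow> real"
  assumes nonneg: "0 \<le> d r"
    and le_one: "d r \<le> 1"
    and average: "d (True # r) + d (False # r) = 2 * d r"
    and decided: "\<exists>w. length w = 3 \<and> d (w @ r) \<in> {0, 1}"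
begin

definition support :: "(nat \<Rightarrow> bool) set" where
  "support = {z. \<forall>n. 0 < d (hist z n)}"

lemma zero_child: "d r = 0 \<Longrightarrow> d (b # r) = 0"
  using average[of r] nonneg[of "True # r"] nonneg[of "False # r"] by (cases b) auto

lemma one_child: "d r = 1 \<Longrightarrow> d (b # r) = 1"
  using average[of r] le_one[of "True # r"] le_one[of "False # r"] by (cases b) auto

lemma zero_hist_mono:
  assumes "d (hist z n) = 0" "n \<le> m"
  shows "d (hist z m) = 0"
  using assms(2,1) by (induction rule: dec_induct) (auto simp: zero_child)

lemma one_hist_mono:
  assumes "d (hist z n) = 1" "n \<le> m"
  shows "d (hist z m) = 1"
  using assms(2,1) by (induction rule: dec_induct) (auto simp: one_child)

text \<open>A positive node has a positive child by averaging; always moving to such a child gives a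
  point of the support.\<close>

lemma support_Int_cyl: "support \<inter> cyl r \<noteq> {} \<longleftrightarrow> 0 < d r"
proof
  assume "0 < d r"
  obtain z where z: "hist z (length r) = r"
      "\<And>n. length r \<le> n \<Longrightarrow> z n = (0 < d (True # hist z n))"
    by (rule stream_extending[of r "\<lambda>h. 0 < d (True # h)"]) blast
  have ge: "0 < d (hist z n)" if "length r \<le> n" for n
    using that
  proof (induction rule: dec_induct)
    case base
    show ?case using z \<open>0 < d r\<close> by simp
  next
    case (step n)
    then show ?case
      using average[of "hist z n"] z(2)[of n] by (cases "z n") auto
  qed
  have "0 < d (hist z n)" for n
  proof (cases "length r \<le> n")
    case False
    then show ?thesis
      using zero_hist_mono[of z n "length r"] ge[of "length r"] nonneg[of "hist z n"] by force
  qed (rule ge)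
  then have "z \<in> support \<inter> cyl r"
    using z(1) by (simp add: support_def cyl_def)
  then show "support \<inter> cyl r \<noteq> {}" by blast
next
  assume "support \<inter> cyl r \<noteq> {}"
  then show "0 < d r"
    by (auto simp: support_def cyl_def dest: spec[of _ "length r"])
qed

lemma cyl_subset_support:
  assumes "d r = 1" shows "cyl r \<subseteq> support"
proof
  fix z assume "z \<in> cyl r"
  then have r: "d (hist z (length r)) = 1" using assms by (simp add: cyl_def)
  have "d (hist z n) \<noteq> 0" for n
    using one_hist_mono[OF r, of n] zero_hist_mono[of z n "length r"] r
    by (cases "n \<le> length r") auto
  then show "z \<in> support"
    using nonneg by (simp add: support_def less_le)
qed

lemma support_eq: "support = (\<Inter>n. \<Union>r\<in>{r. length r = n \<and> 0 < d r}. cyl r)"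
  by (auto simp: support_def cyl_def)

lemma support_measurable [measurable]: "support \<in> sets coin"
proof -
  have "countable {r :: bool list. length r = n \<and> 0 < d r}" for n
    by (rule countableI_type)
  then show ?thesis
    unfolding support_eq using sets.top[of coin]
    by (intro sets.countable_INT'' sets.countable_UN') auto
qed

text \<open>Relative mass and martingale obey the same averaging rule, hence so does their
  difference, which vanishes where \<open>d\<close> is 0 or 1. Such a node lies three levels below
  every node, so any uniform bound on the difference can be improved by the factor 7/8, again and
  again.\<close>

lemma measure_support_cyl: "measure coin (support \<inter> cyl r) = d r / 2 ^ length r"
proof -
  interpret prob_space coin by (rule prob_space_coin)
  \<comment> \<open>The factor \<open>2 ^ length r\<close> turns mass into density inside
    \<open>cyl r\<close>, which is the quantity that averages over the children.\<close>
  define g where "g r = measure coin (support \<inter> cyl r) * 2 ^ length r - d r" for r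
  have avg: "g (True # r) + g (False # r) = 2 * g r" for r
  proof -
    have "support \<inter> cyl r = (support \<inter> cyl (True # r)) \<union> (support \<inter> cyl (False # r))"
      using cyl_split by blast
    then have "measure coin (support \<inter> cyl r) =
        measure coin (support \<inter> cyl (True # r)) + measure coin (support \<inter> cyl (False # r))"
      using cyl_disjoint[of r] by (auto intro!: finite_measure_Union)
    then show ?thesis
      using average[of r] by (simp add: g_def algebra_simps)
  qed
  have mass: "measure coin (support \<inter> cyl r) * 2 ^ length r \<le> 1" for r
  proof -
    have "measure coin (support \<inter> cyl r) \<le> measure coin (cyl r)"
      by (intro finite_measure_mono) auto
    then show ?thesis by (simp add: measure_cyl field_simps)
  qed
  have bound: "\<bar>g r\<bar> \<le> 1" for r
  proof -
    have "0 \<le> measure coin (support \<inter> cyl r) * 2 ^ length r" by simp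
    then show ?thesis
      using mass[of r] nonneg[of r] le_one[of r] unfolding g_def by linarith
  qed
  have vanish: "g r = 0" if "d r \<in> {0, 1}" for r
  proof (cases "d r = 0")
    case True
    then have "support \<inter> cyl r = {}" using support_Int_cyl[of r] by auto
    then show ?thesis using True by (simp add: g_def)
  next
    case False
    then have "support \<inter> cyl r = cyl r" using that cyl_subset_support by blast
    then show ?thesis using that False by (simp add: g_def measure_cyl)
  qed
  have "\<bar>g r\<bar> \<le> (7/8) ^ n" for n r
  proof (induction n arbitrary: r)
    case (Suc n)
    obtain w where "length w = 3" "d (w @ r) \<in> {0, 1}" using decided by blast
    then show ?case
      using average_zero_bound[of g "(7/8) ^ n" w r] avg Suc vanish by simp
  qed (simp add: bound)
  moreover have "(\<lambda>n. (7/8) ^ n :: real) \<longlonglongrightarrow> 0"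
    by (rule LIMSEQ_power_zero) simp
  ultimately have "\<bar>g r\<bar> \<le> 0"
    by (intro LIMSEQ_le_const) auto
  then show ?thesis
    by (simp add: g_def field_simps)
qed

lemma dens_seq_support: "dens_seq support z n = d (hist z n)"
  by (simp add: dens_seq_def Nbhd_restr measure_support_cyl measure_cyl)

end

section \<open>Topology of the Cantor space and compactness of supports\<close>

lemma topspace_cantor [simp]: "topspace cantor_top = UNIV"
  by (simp add: cantor_top_def)

lemma openin_cyl: "openin cantor_top (cyl r)"
proof -
  obtain x :: "nat \<Rightarrow> bool" where x: "hist x (length r) = r"
    by (rule stream_extending[of r "\<lambda>_. True"])
  have "openin cantor_top (PiE UNIV (\<lambda>i. if i < length r then {x i} else UNIV))"
    unfolding cantor_top_def
    by (rule product_topology_basis) (auto simp: finite_subset[of _ "{..<length r}"] subset_iff)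
  moreover have "PiE UNIV (\<lambda>i. if i < length r then {x i} else UNIV) = cyl r"
    using cyl_hist[of x "length r"] x by (auto simp: PiE_iff split: if_splits)
  ultimately show ?thesis by simp
qed

lemma cyl_basis:
  assumes "openin cantor_top V" "z \<in> V"
  obtains n where "cyl (hist z n) \<subseteq> V"
proof -
  obtain X where X: "finite {i. X i \<noteq> (UNIV::bool set)}" "z \<in> PiE UNIV X" "PiE UNIV X \<subseteq> V"
    using assms unfolding cantor_top_def openin_product_topology_alt by fastforce
  obtain n where n: "\<And>i. X i \<noteq> UNIV \<Longrightarrow> i < n"
    using X(1) finite_nat_set_iff_bounded[of "{i. X i \<noteq> (UNIV::bool set)}"] by auto
  have "cyl (hist z n) \<subseteq> PiE UNIV X"
  proof
    fix x assume x: "x \<in> cyl (hist z n)"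
    have "x i \<in> X i" for i
    proof (cases "i < n")
      case True then show ?thesis using x X(2) by (simp add: cyl_hist PiE_iff)
    next
      case False then show ?thesis using n[of i] by auto
    qed
    then show "x \<in> PiE UNIV X" by auto
  qed
  then show thesis
    by (rule that[OF order.trans[OF _ X(3)]])
qed

lemma compact_space_cantor: "compact_space cantor_top"
  by (simp add: cantor_top_def compact_space_product_topology compact_space_discrete_topology)

text \<open>Leaving the support is witnessed by a finite history of value 0, so the complement is a
  union of cylinders.\<close>

lemma (in decided_martingale) compactin_support: "compactin cantor_top support"
proof -
  have "openin cantor_top (\<Union>r\<in>{r. d r = 0}. cyl r)"
    by (intro openin_Union) (auto intro: openin_cyl)
  moreover have "(\<Union>r\<in>{r. d r = 0}. cyl r) = UNIV - support"
  proof -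
    have "(\<exists>r. d r = 0 \<and> hist z (length r) = r) \<longleftrightarrow> (\<exists>n. \<not> 0 < d (hist z n))" for z
      using nonneg by (metis length_hist less_irrefl less_le)
    then show ?thesis by (simp add: support_def cyl_def set_eq_iff)
  qed
  ultimately have "closedin cantor_top support"
    by (simp add: closedin_def)
  then show ?thesis
    by (simp add: compact_space_cantor closedin_compact_space)
qed

section \<open>Steered sequences\<close>

text \<open>
  The point of \<open>[2p - 1, 2p]\<close> closest to \<open>q\<close>. This interval consists of the values at a child for
  which both the child and its sibling, with value \<open>2p - steer p q\<close>, can stay in \<open>[0, 1]\<close>.
\<close>

definition steer :: "real \<Rightarrow> real \<Rightarrow> real" where
  "steer p q = max (2 * p - 1) (min (2 * p) q)"

lemma steer_self: "0 \<le> p \<Longrightarrow> p \<le> 1 \<Longrightarrow> steer p p = p"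
  by (simp add: steer_def)

lemma steer_ge: "0 \<le> p \<Longrightarrow> min p q \<le> steer p q"
  and steer_le: "p \<le> 1 \<Longrightarrow> steer p q \<le> max p q"
  by (auto simp: steer_def)

lemma steer_sibling: "0 \<le> p \<Longrightarrow> p \<le> 1 \<Longrightarrow> 0 \<le> 2 * p - steer p q \<and> 2 * p - steer p q \<le> 1"
  by (auto simp: steer_def)

lemma steer_reflect: "steer (1 - p) (1 - q) = 1 - steer p q"
  by (auto simp: steer_def max_def min_def)

lemma steer_fixed: "0 < p \<Longrightarrow> p < 1 \<Longrightarrow> steer p q = p \<Longrightarrow> p = q"
  by (auto simp: steer_def max_def min_def split: if_splits)

lemma tendsto_steer:
  "(f \<longlongrightarrow> p) F \<Longrightarrow> (g \<longlongrightarrow> q) F \<Longrightarrow> ((\<lambda>x. steer (f x) (g x)) \<longlongrightarrow> steer p q) F"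
  unfolding steer_def by (intro tendsto_intros)

text \<open>Below \<open>e\<close> the sequence would double forever once the targets exceed
  \<open>e\<close>, so it must reach \<open>e\<close>; from then on no step can fall below the
  smaller of the current value and the target.\<close>

lemma steered_eventually_above:
  fixes a q :: "nat \<Rightarrow> real"
  assumes step: "\<And>i. a (Suc i) = steer (a i) (q i)"
    and pos: "\<And>i. 0 < a i"
    and lim: "q \<longlonglongrightarrow> l" and e: "e < l"
  shows "\<forall>\<^sub>F i in sequentially. e \<le> a i"
proof -
  obtain N where N: "\<And>n. n \<ge> N \<Longrightarrow> e < q n"
    using order_tendstoD(1)[OF lim e] by (auto simp: eventually_sequentially)
  have "\<exists>n\<ge>N. e \<le> a n"
  proof (rule ccontr)
    assume "\<not> (\<exists>n\<ge>N. e \<le> a n)"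
    then have low: "a n < e" if "n \<ge> N" for n
      using that by force
    have "2 ^ k * a N \<le> a (N + k)" for k
    proof (induction k)
      case (Suc k)
      \<comment> \<open>The new value is still below \<open>e\<close>, hence below the target, so
        the step was not capped by the target and at least doubled.\<close>
      have "2 * a (N + k) \<le> a (Suc (N + k))"
        using low[of "Suc (N + k)"] N[of "N + k"] step[of "N + k"]
        by (auto simp: steer_def max_def min_def split: if_splits)
      then show ?case using Suc by simp
    qed simp
    then have *: "2 ^ k < e / a N" for k :: nat
      using low[of "N + k"] pos[of N] by (auto simp: pos_less_divide_eq intro: le_less_trans)
    obtain k :: nat where "e / a N < 2 ^ k"
      using real_arch_pow[of 2 "e / a N"] by auto
    then show False using *[of k] by simp
  qed
  then obtain M where M: "M \<ge> N" "e \<le> a M" by blast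
  have "e \<le> a n" if "n \<ge> M" for n
    using that
  proof (induction rule: dec_induct)
    case (step n)
    then show ?case
      using steer_ge[of "a n" "q n"] pos[of n] N[of n] M assms(1)[of n] by (auto simp: min_def split: if_splits)
  qed (rule M)
  then show ?thesis
    by (auto simp: eventually_sequentially)
qed

text \<open>Only the lower bound needs an argument: \<open>steer_reflect\<close> turns the upper one
  into the lower one for \<open>1 - a\<close> and \<open>1 - q\<close>.\<close>

lemma steered_tendsto:
  fixes a q :: "nat \<Rightarrow> real"
  assumes step: "\<And>i. a (Suc i) = steer (a i) (q i)"
    and range: "\<And>i. 0 < a i \<and> a i < 1"
    and lim: "q \<longlonglongrightarrow> l"
  shows "a \<longlonglongrightarrow> l"
proof (rule order_tendstoI)
  fix e assume "e < l"
  then obtain e' where "e < e'" "e' < l" using dense by blast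
  then show "\<forall>\<^sub>F i in sequentially. e < a i"
    using steered_eventually_above[OF step _ lim, of e'] range
    by (auto elim!: eventually_mono)
next
  fix e assume "l < e"
  then obtain e' where e': "l < e'" "e' < e" using dense by blast
  have "\<forall>\<^sub>F i in sequentially. 1 - e' \<le> 1 - a i"
  proof (rule steered_eventually_above)
    show "1 - a (Suc i) = steer (1 - a i) (1 - q i)" for i
      by (simp add: step steer_reflect)
    show "0 < 1 - a i" for i using range[of i] by simp
    show "(\<lambda>i. 1 - q i) \<longlonglongrightarrow> 1 - l" by (intro tendsto_intros lim)
  qed (use e' in auto)
  then show "\<forall>\<^sub>F i in sequentially. a i < e"
    by eventually_elim (use e' in auto)
qed

text \<open>A limit inside (0, 1) would be a fixed point of steering towards \<open>v\<close> and
  also towards \<open>w\<close>, but there the only fixed point is the target itself.\<close>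

lemma steered_alternating_divergent:
  fixes a q :: "nat \<Rightarrow> real"
  assumes step: "\<And>i. a (Suc i) = steer (a i) (q i)"
    and range: "\<And>i. 0 < a i \<and> a i < 1"
    and q: "\<And>i. N \<le> i \<Longrightarrow> q i = (if even i then v else w)"
    and "0 < v" "v < w" "w < 1"
  shows "\<not> convergent a"
proof
  assume "convergent a"
  then obtain l where l: "a \<longlonglongrightarrow> l" by (auto simp: convergent_def)
  have lower: "min (a N) v \<le> a i" if "N \<le> i" for i
    using that
  proof (induction rule: dec_induct)
    case (step n)
    have "min (a n) (q n) \<le> a (Suc n)"
      using steer_ge[of "a n" "q n"] range[of n] assms(1)[of n] by auto
    then show ?case using step q[of n] \<open>v < w\<close> by (auto simp: min_def split: if_splits)
  qed simp
  have upper: "a i \<le> max (a N) w" if "N \<le> i" for i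
    using that
  proof (induction rule: dec_induct)
    case (step n)
    have "a (Suc n) \<le> max (a n) (q n)"
      using steer_le[of "a n" "q n"] range[of n] assms(1)[of n] by auto
    then show ?case using step q[of n] \<open>v < w\<close> by (auto simp: max_def split: if_splits)
  qed simp
  \<comment> \<open>These bounds keep the limit away from 0 and 1, which \<open>steer\<close> fixes
    whatever target in [0, 1] is given.\<close>
  have "min (a N) v \<le> l"
    by (rule LIMSEQ_le_const[OF l]) (use lower in blast)
  then have "0 < l" using range[of N] \<open>0 < v\<close> by auto
  have "l \<le> max (a N) w"
    by (rule LIMSEQ_le_const2[OF l]) (use upper in blast)
  then have "l < 1" using range[of N] \<open>w < 1\<close> by auto
  \<comment> \<open>Along the indices \<open>2 * i + k\<close> the target is eventually constant;
    \<open>k = 0\<close> gives \<open>v\<close> and \<open>k = 1\<close> gives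
    \<open>w\<close>.\<close>
  have fixed: "l = x" if x: "\<And>i. N \<le> i \<Longrightarrow> q (2 * i + k) = x" for k x
  proof -
    have sub: "filterlim (\<lambda>i. 2 * i + k) sequentially sequentially"
      by (rule filterlim_subseq) (auto simp: strict_mono_def)
    have "(\<lambda>i. a (Suc (2 * i + k))) \<longlonglongrightarrow> l"
      using filterlim_compose[OF LIMSEQ_Suc[OF l] sub] by simp
    moreover have "\<forall>\<^sub>F i in sequentially. a (Suc (2 * i + k)) = steer (a (2 * i + k)) x"
      by (rule eventually_sequentiallyI[of N]) (simp add: step x)
    ultimately have "(\<lambda>i. steer (a (2 * i + k)) x) \<longlonglongrightarrow> l"
      by (rule Lim_transform_eventually)
    moreover have "(\<lambda>i. steer (a (2 * i + k)) x) \<longlonglongrightarrow> steer l x"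
      by (intro tendsto_steer tendsto_const filterlim_compose[OF l sub])
    ultimately have "steer l x = l"
      using LIMSEQ_unique by blast
    then show ?thesis
      using steer_fixed \<open>0 < l\<close> \<open>l < 1\<close> by blast
  qed
  have "l = v" by (rule fixed[of 0]) (simp add: q)
  moreover have "l = w" by (rule fixed[of 1]) (simp add: q)
  ultimately show False using \<open>v < w\<close> by simp
qed

section \<open>Branches of trees\<close>

text \<open>The chain may pause at some steps, so entry \<open>i\<close> of the branch is taken from
  any list long enough to have it; all such lists agree there.\<close>

lemma branch_of_chain:
  fixes L :: "nat \<Rightarrow> 'a list"
  assumes chain: "\<And>n. take (length (L n)) (L (Suc n)) = L n"
    and unbounded: "\<And>m. \<exists>n. m \<le> length (L n)"
  obtains x where "\<And>n. L n = restr x (length (L n))"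
proof -
  have mono: "take (length (L n)) (L m) = L n" if "n \<le> m" for n m
    using that
  proof (induction rule: dec_induct)
    case (step m)
    then have "length (L n) \<le> length (L m)"
      by (metis length_take min.cobounded1 min.commute)
    then have "take (length (L n)) (take (length (L m)) (L (Suc m))) = take (length (L n)) (L (Suc m))"
      by (simp add: min_absorb1)
    then show ?case using step chain[of m] by simp
  qed simp
  have agree: "L n ! i = L m ! i" if "i < length (L n)" "i < length (L m)" for n m i
    using that mono[of n m] mono[of m n] by (metis nat_le_linear nth_take)
  define x where "x i = L (SOME n. i < length (L n)) ! i" for i
  have "x i = L n ! i" if "i < length (L n)" for n i
    unfolding x_def using that by (intro agree) (rule someI)
  then have "L n = restr x (length (L n))" for n
    by (intro nth_equalityI) (auto simp: restr_def)
  then show thesis by (rule that)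
qed

lemma body_of_chain:
  fixes L :: "nat \<Rightarrow> 'a list"
  assumes "pruned_tree U" "\<And>n. L n \<in> U"
    and unbounded: "\<And>m. \<exists>n. m \<le> length (L n)"
    and x: "\<And>n. L n = restr x (length (L n))"
  shows "x \<in> body U"
  unfolding body_def
proof safe
  fix m
  obtain n where "m \<le> length (L n)" using unbounded by blast
  then have "restr x m = take m (L n)"
    using x[of n] by (metis take_restr)
  then show "restr x m \<in> U"
    using assms(1,2) by (auto simp: pruned_tree_def)
qed

lemma Nil_in_pruned_tree: "pruned_tree U \<Longrightarrow> [] \<in> U"
  unfolding pruned_tree_def by (metis all_not_in_conv take0)

lemma pruned_tree_branch:
  assumes U: "pruned_tree U" and "u \<in> U"
  obtains x where "x \<in> body U" "restr x (length u) = u"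
proof -
  obtain f where f: "\<And>s. s \<in> U \<Longrightarrow> f s \<in> U \<and> length s < length (f s) \<and> take (length s) (f s) = s"
    using U unfolding pruned_tree_def by metis
  define L where "L n = (f ^^ n) u" for n
  have L: "L n \<in> U" for n
    by (induction n) (auto simp: L_def \<open>u \<in> U\<close> f)
  have L_Suc: "L (Suc n) = f (L n)" for n by (simp add: L_def)
  have len: "n \<le> length (L n)" for n
  proof (induction n)
    case (Suc n)
    then show ?case using f[OF L[of n]] L_Suc[of n] by simp
  qed simp
  have unbounded: "\<exists>n. m \<le> length (L n)" for m
    using len by blast
  obtain x where x: "\<And>n. L n = restr x (length (L n))"
    by (rule branch_of_chain[of L]) (use f L L_Suc unbounded in auto)
  show thesis
  proof (rule that)
    show "x \<in> body U"
      by (rule body_of_chain[of U L, OF U L unbounded x])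
    show "restr x (length u) = u"
      using x[of 0] by (simp add: L_def)
  qed
qed

section \<open>The martingale of a tree\<close>

text \<open>
  The bits at odd positions are read as a sequence of unary numbers \<open>k\<close>. The parity of \<open>k\<close> is the
  next entry of the branch \<open>y\<close> and, if it is 1, then \<open>k div 2\<close> is the next entry of \<open>x\<close>.
\<close>

fun feed :: "bool \<Rightarrow> bool list \<times> nat list \<times> nat \<Rightarrow> bool list \<times> nat list \<times> nat" where
  "feed b (t, u, k) =
     (if \<not> b then (t, u, Suc k)
      else if odd k then (t @ [True], u @ [k div 2], 0)
      else (t @ [False], u, 0))"

primrec parse :: "bool list \<Rightarrow> bool list \<times> nat list \<times> nat" where
  "parse [] = ([], [], 0)"
| "parse (b # r) = (if even (length r) then parse r else feed b (parse r))"

definition first_part :: "bool list \<Rightarrow> bool list" where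
  "first_part r = fst (parse r)"

definition second_part :: "bool list \<Rightarrow> nat list" where
  "second_part r = fst (snd (parse r))"

lemma parts_Nil [simp]: "first_part [] = []" "second_part [] = []"
  by (simp_all add: first_part_def second_part_def)

lemma first_part_chain: "take (length (first_part r)) (first_part (b # r)) = first_part r"
  and second_part_chain: "take (length (second_part r)) (second_part (b # r)) = second_part r"
  and length_first_part_Cons: "length (first_part (b # r)) \<le> Suc (length (first_part r))"
  by (cases "parse r"; simp add: first_part_def second_part_def)+

lemma length_first_part: "length (first_part r) \<le> length r"
proof (induction r)
  case (Cons b r)
  then show ?case using length_first_part_Cons[of b r] by simp
qed simp

text \<open>The link between the two decoded branches: an entry for \<open>U\<close> is read exactly
  when a 1 is read for \<open>T\<close>, so endless progress in \<open>U\<close> amounts to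
  infinitely many ones.\<close>

lemma count_first_part: "length (filter id (first_part r)) = length (second_part r)"
proof (induction r)
  case (Cons b r)
  then show ?case by (cases "parse r") (simp add: first_part_def second_part_def)
qed simp

text \<open>The number \<open>v u\<close> stands for an approximation to the value of
  \<open>c\<close> on branches through \<open>u\<close>; it will be \<open>c\<close> at one chosen
  branch.\<close>

locale steering =
  fixes U :: "nat list set" and v :: "nat list \<Rightarrow> real"
  assumes Nil_in_U: "[] \<in> U"
    and v_range: "u \<in> U \<Longrightarrow> 0 < v u \<and> v u < 1"
begin

text \<open>For fixed \<open>u\<close> the two targets differ, which forces oscillation, while their
  gap tends to 0 as \<open>u\<close> grows. The summand 2 in the denominator keeps the upper target
  below 1 even for empty \<open>u\<close>.\<close>

definition target :: "nat list \<Rightarrow> nat \<Rightarrow> real" where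
  "target u i = (if even i then v u else v u + (1 - v u) / real (length u + 2))"

text \<open>Even positions are reserved for steering: \<open>False\<close> follows the steered
  child, \<open>True\<close> leaves for its sibling. This guarantees that every node has inactive
  descendants close by, whatever the trees are.\<close>

primrec active :: "(bool list \<Rightarrow> bool) \<Rightarrow> bool list \<Rightarrow> bool" where
  "active T [] = True"
| "active T (b # r) \<longleftrightarrow> active T r \<and> (even (length r) \<longrightarrow> \<not> b) \<and>
     T (first_part (b # r)) \<and> second_part (b # r) \<in> U"

text \<open>
  Aiming at 1 from an inactive node produces the lexicographic initial segment, and aiming at the
  current value \<open>p\<close>, while an encoding bit is read, gives both children the value \<open>p\<close>.
\<close>

definition aim :: "(bool list \<Rightarrow> bool) \<Rightarrow> bool list \<Rightarrow> real \<Rightarrow> real" where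
  "aim T r p = (if \<not> active T r then 1
     else if even (length r) then target (second_part r) (length r div 2) else p)"

primrec mart :: "(bool list \<Rightarrow> bool) \<Rightarrow> bool list \<Rightarrow> real" where
  "mart T [] = 1 / 2"
| "mart T (b # r) = (if b then 2 * mart T r - steer (mart T r) (aim T r (mart T r))
     else steer (mart T r) (aim T r (mart T r)))"

lemma target_range:
  assumes "u \<in> U"
  shows "v u < v u + (1 - v u) / real (length u + 2)"
    "v u + (1 - v u) / real (length u + 2) < 1"
    "0 < target u i" "target u i < 1"
proof -
  have *: "0 < v u" "v u < 1" using v_range[OF assms] by auto
  then have "(1 - v u) * 1 < (1 - v u) * real (length u + 2)"
    by (intro mult_strict_left_mono) auto
  then have "(1 - v u) / real (length u + 2) < 1 - v u"
    by (simp add: pos_divide_less_eq del: of_nat_add)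
  then show **: "v u + (1 - v u) / real (length u + 2) < 1" by simp
  show ***: "v u < v u + (1 - v u) / real (length u + 2)" using * by simp
  show "0 < target u i" "target u i < 1"
    using * ** *** by (auto simp: target_def)
qed

lemma active_in_U: "active T r \<Longrightarrow> second_part r \<in> U"
  by (cases r) (auto simp: Nil_in_U)

lemma active_in_T: "active T r \<Longrightarrow> T [] \<Longrightarrow> T (first_part r)"
  by (cases r) auto

lemma mart_range: "0 \<le> mart T r \<and> mart T r \<le> 1"
proof (induction r)
  case (Cons b r)
  have "0 \<le> aim T r (mart T r) \<and> aim T r (mart T r) \<le> 1"
    using Cons target_range(3,4)[OF active_in_U, of T r "length r div 2"] by (auto simp: aim_def)
  then show ?case
    using Cons steer_sibling[of "mart T r" "aim T r (mart T r)"]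
      steer_ge[of "mart T r" "aim T r (mart T r)"] steer_le[of "mart T r" "aim T r (mart T r)"]
    by (auto simp: min_def max_def split: if_splits)
qed simp

text \<open>An active history never enters a steering sibling: each step keeps the value or moves it
  towards a target inside (0, 1).\<close>

lemma mart_active_range: "active T r \<Longrightarrow> 0 < mart T r \<and> mart T r < 1"
proof (induction r)
  case (Cons b r)
  then have *: "active T r" "0 < mart T r" "mart T r < 1" by auto
  show ?case
  proof (cases "even (length r)")
    case True
    then have "aim T r (mart T r) = target (second_part r) (length r div 2)" "\<not> b"
      using Cons.prems * by (auto simp: aim_def)
    moreover have "0 < target (second_part r) (length r div 2)"
        "target (second_part r) (length r div 2) < 1"
      using target_range(3,4)[OF active_in_U[OF *(1)]] by auto
    ultimately show ?thesis
      using * steer_ge[of "mart T r" "target (second_part r) (length r div 2)"]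
        steer_le[of "mart T r" "target (second_part r) (length r div 2)"]
      by (auto simp: min_def max_def split: if_splits)
  next
    case False
    then show ?thesis using * by (simp add: aim_def steer_self)
  qed
qed simp

text \<open>With target 1 the children of a node of value \<open>p\<close> have values
  \<open>min 1 (2 * p)\<close> and \<open>max 0 (2 * p - 1)\<close>, equally far from
  \<open>p\<close>.\<close>

lemma stopped_step:
  assumes "\<not> active T r"
  shows "\<bar>mart T (b # r) - mart T r\<bar> = min (mart T r) (1 - mart T r)"
  using mart_range[of T r] assms by (auto simp: aim_def steer_def min_def max_def)

text \<open>Below 1/2 the \<open>True\<close> child is 0; otherwise the \<open>False\<close> child
  is 1.\<close>

lemma stopped_decided: "\<not> active T r \<Longrightarrow> \<exists>b. mart T (b # r) \<in> {0, 1}"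
  using mart_range[of T r]
  by (intro exI[of _ "mart T r < 1/2"]) (auto simp: aim_def steer_def)

sublocale mart: decided_martingale "mart T" for T
proof
  fix r
  show "0 \<le> mart T r" "mart T r \<le> 1" using mart_range[of T r] by auto
  show "mart T (True # r) + mart T (False # r) = 2 * mart T r" by simp
  \<comment> \<open>The last list entry is appended first. If \<open>length r\<close> is even, that
    bit is \<open>True\<close> and stops the history at once; otherwise it is \<open>False\<close>,
    and the next bit \<open>True\<close> falls on an even position. A third bit then reaches 0 or
    1.\<close>
  let ?w = "[True, even (length r)]"
  have "\<not> active T (?w @ r)" by simp
  then obtain b where "mart T (b # ?w @ r) \<in> {0, 1}"
    using stopped_decided by blast
  then show "\<exists>w. length w = 3 \<and> mart T (w @ r) \<in> {0, 1}"
    by (intro exI[of _ "b # ?w"]) simp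
qed

abbreviation K :: "(bool list \<Rightarrow> bool) \<Rightarrow> (nat \<Rightarrow> bool) set" where
  "K T \<equiv> mart.support T"

text \<open>The source of continuity: a history of length \<open>n\<close> decodes at most
  \<open>n\<close> entries for \<open>T\<close>, so each value consults only finitely many nodes of
  the tree.\<close>

lemma mart_cong:
  assumes "\<And>s. length s \<le> length r \<Longrightarrow> T s = T' s"
  shows "mart T r = mart T' r"
proof -
  have "active T r = active T' r \<and> mart T r = mart T' r"
    using assms
  proof (induction r)
    case (Cons b r)
    then show ?case
      using length_first_part[of "b # r"] by (auto simp: aim_def)
  qed simp
  then show ?thesis by simp
qed

end

section \<open>Continuity\<close>

lemma openin_PrTr2_agree:
  "openin PrTr2_top {T' \<in> PrTr2. \<forall>s. length s \<le> n \<longrightarrow> T' s = T s}"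
proof -
  let ?X = "\<lambda>s :: bool list. if length s \<le> n then {T s} else UNIV"
  have "finite {s :: bool list. set s \<subseteq> UNIV \<and> length s \<le> n}"
    by (rule finite_lists_length_le) simp
  then have "openin (product_topology (\<lambda>_. discrete_topology UNIV) UNIV) (PiE UNIV ?X)"
    by (intro product_topology_basis) (auto elim!: rev_finite_subset)
  then have "openin PrTr2_top (PiE UNIV ?X \<inter> PrTr2)"
    unfolding PrTr2_top_def openin_subtopology by blast
  moreover have "PiE UNIV ?X \<inter> PrTr2 = {T' \<in> PrTr2. \<forall>s. length s \<le> n \<longrightarrow> T' s = T s}"
    by (rule set_eqI) (simp add: PiE_iff, metis UNIV_I singleton_iff)
  ultimately show ?thesis by simp
qed

lemma topspace_PrTr2 [simp]: "topspace PrTr2_top = PrTr2"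
  by (simp add: PrTr2_top_def)

context steering
begin

lemma continuous_K: "continuous_map PrTr2_top vietoris_top K"
proof -
  \<comment> \<open>Trees agreeing with \<open>T\<close> up to a fixed length form an open set, so
    it suffices that membership in the subbasic set is decided by a finite part of
    \<open>T\<close>.\<close>
  have local_open: "openin PrTr2_top (K -` \<V> \<inter> PrTr2)"
    if near: "\<And>T. K T \<in> \<V> \<Longrightarrow> \<exists>n. \<forall>T'. (\<forall>s. length s \<le> n \<longrightarrow> T' s = T s) \<longrightarrow> K T' \<in> \<V>" for \<V>
  proof (subst openin_subopen, rule ballI)
    fix T assume T: "T \<in> K -` \<V> \<inter> PrTr2"
    then obtain n where n: "\<forall>T'. (\<forall>s. length s \<le> n \<longrightarrow> T' s = T s) \<longrightarrow> K T' \<in> \<V>"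
      using near[of T] by auto
    show "\<exists>W. openin PrTr2_top W \<and> T \<in> W \<and> W \<subseteq> K -` \<V> \<inter> PrTr2"
      by (rule exI[of _ "{T' \<in> PrTr2. \<forall>s. length s \<le> n \<longrightarrow> T' s = T s}"])
        (use T n in \<open>auto simp: openin_PrTr2_agree\<close>)
  qed
  have upper: "openin PrTr2_top (K -` {C. C \<subseteq> V} \<inter> PrTr2)" if V: "openin cantor_top V" for V
  proof (rule local_open)
    fix T assume "K T \<in> {C. C \<subseteq> V}"
    then have sub: "K T \<subseteq> V" by simp
    \<comment> \<open>Every point outside \<open>V\<close> passes through a node of value 0. By
      compactness finitely many such nodes suffice, and trees agreeing with \<open>T\<close> up to
      their lengths have the same zeros there.\<close>
    have "UNIV - V \<subseteq> \<Union> (cyl ` {r. mart T r = 0})"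
    proof
      fix z assume "z \<in> UNIV - V"
      then have "z \<notin> K T" using sub by auto
      then obtain n where "\<not> 0 < mart T (hist z n)"
        by (auto simp: mart.support_def)
      then have "mart T (hist z n) = 0"
        using mart.nonneg[of T "hist z n"] by linarith
      then show "z \<in> \<Union> (cyl ` {r. mart T r = 0})"
        by (intro UN_I[of "hist z n"]) auto
    qed
    moreover have "compactin cantor_top (UNIV - V)"
      using V by (intro closedin_compact_space compact_space_cantor) (simp add: closedin_def double_diff)
    ultimately obtain F where "finite F" "F \<subseteq> cyl ` {r. mart T r = 0}" "UNIV - V \<subseteq> \<Union> F"
      using compactinD[of cantor_top "UNIV - V" "cyl ` {r. mart T r = 0}"] openin_cyl by blast
    then obtain R where R: "finite R" "R \<subseteq> {r. mart T r = 0}" "UNIV - V \<subseteq> \<Union> (cyl ` R)"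
      by (metis finite_subset_image)
    obtain n where n: "\<And>r. r \<in> R \<Longrightarrow> length r \<le> n"
      using finite_nat_set_iff_bounded_le[of "length ` R"] R(1) by auto
    have "K T' \<subseteq> V" if T': "\<forall>s. length s \<le> n \<longrightarrow> T' s = T s" for T'
    proof
      fix z assume z: "z \<in> K T'"
      show "z \<in> V"
      proof (rule ccontr)
        assume "z \<notin> V"
        then obtain r where r: "r \<in> R" "z \<in> cyl r" using R(3) by blast
        have "mart T' r = mart T r"
          by (rule mart_cong) (use T' n[OF r(1)] in auto)
        then show False
          using z r R(2) mart.support_Int_cyl[of T' r] by auto
      qed
    qed
    then show "\<exists>n. \<forall>T'. (\<forall>s. length s \<le> n \<longrightarrow> T' s = T s) \<longrightarrow> K T' \<in> {C. C \<subseteq> V}"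
      by blast
  qed
  have lower: "openin PrTr2_top (K -` {C. C \<inter> V \<noteq> {}} \<inter> PrTr2)" if V: "openin cantor_top V" for V
  proof (rule local_open)
    fix T assume "K T \<in> {C. C \<inter> V \<noteq> {}}"
    then obtain z where z: "z \<in> K T" "z \<in> V" by blast
    \<comment> \<open>One positive node whose cylinder lies in \<open>V\<close> is enough, and its
      value survives for trees agreeing up to length \<open>n\<close>.\<close>
    obtain n where n: "cyl (hist z n) \<subseteq> V"
      using cyl_basis[OF V z(2)] .
    have "K T' \<inter> V \<noteq> {}" if T': "\<forall>s. length s \<le> n \<longrightarrow> T' s = T s" for T'
    proof -
      have "mart T' (hist z n) = mart T (hist z n)"
        by (rule mart_cong) (use T' in auto)
      then have "0 < mart T' (hist z n)"
        using z(1) by (simp add: mart.support_def)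
      then show ?thesis
        using mart.support_Int_cyl[of T' "hist z n"] n by blast
    qed
    then show "\<exists>n. \<forall>T'. (\<forall>s. length s \<le> n \<longrightarrow> T' s = T s) \<longrightarrow> K T' \<in> {C. C \<inter> V \<noteq> {}}"
      by blast
  qed
  show ?thesis
    unfolding vietoris_top_def
  proof (intro continuous_map_into_subtopology continuous_on_generated_topo)
    show "K \<in> topspace PrTr2_top \<rightarrow> Kspace"
      by (simp add: Kspace_def mart.compactin_support)
    have "openin cantor_top UNIV"
      using openin_topspace[of cantor_top] by simp
    then show "K ` topspace PrTr2_top \<subseteq> \<Union> ({{C. C \<subseteq> V} |V. openin cantor_top V} \<union>
        {{C. C \<inter> V \<noteq> {}} |V. openin cantor_top V})"
      by blast
  qed (use upper lower in auto)
qed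

section \<open>Limits along points\<close>

lemma stopped_mono:
  assumes "\<not> active T (hist z N)" "N \<le> n"
  shows "\<not> active T (hist z n)"
  using assms(2,1) by (induction rule: dec_induct) auto

text \<open>Convergence makes the steps tend to 0, but after stopping each step has size
  \<open>min p (1 - p)\<close>, so this quantity vanishes at the limit.\<close>

lemma stopped_limit:
  assumes "\<not> active T (hist z N)" and lim: "(\<lambda>n. mart T (hist z n)) \<longlonglongrightarrow> l"
  shows "l \<in> {0, 1}"
proof -
  let ?p = "\<lambda>n. mart T (hist z n)"
  have "(\<lambda>n. \<bar>?p (Suc n) - ?p n\<bar>) \<longlonglongrightarrow> \<bar>l - l\<bar>"
    by (intro tendsto_intros lim LIMSEQ_Suc[OF lim])
  moreover have "\<forall>\<^sub>F n in sequentially. \<bar>?p (Suc n) - ?p n\<bar> = min (?p n) (1 - ?p n)"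
    by (rule eventually_sequentiallyI[of N])
      (use stopped_step[OF stopped_mono[OF assms(1)]] in \<open>simp del: mart.simps\<close>)
  ultimately have "(\<lambda>n. min (?p n) (1 - ?p n)) \<longlonglongrightarrow> \<bar>l - l\<bar>"
    by (rule Lim_transform_eventually)
  moreover have "(\<lambda>n. min (?p n) (1 - ?p n)) \<longlonglongrightarrow> min l (1 - l)"
    by (intro tendsto_intros lim)
  ultimately have "min l (1 - l) = \<bar>l - l\<bar>"
    using LIMSEQ_unique by blast
  then show ?thesis by (auto simp: min_def split: if_splits)
qed

lemma dens_exists_K: "dens_exists (K T) z \<longleftrightarrow> convergent (\<lambda>n. mart T (hist z n))"
  by (simp add: dens_exists_def mart.dens_seq_support[abs_def])

lemma dens_K: "(\<lambda>n. mart T (hist z n)) \<longlonglongrightarrow> l \<Longrightarrow> dens (K T) z = l"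
  by (simp add: dens_def mart.dens_seq_support[abs_def] limI)

lemma ran_dens_K: "l \<in> ran_dens (K T) \<longleftrightarrow> (\<exists>z. (\<lambda>n. mart T (hist z n)) \<longlonglongrightarrow> l)"
proof
  assume "l \<in> ran_dens (K T)"
  then obtain z where z: "l = dens (K T) z" "dens_exists (K T) z"
    by (auto simp: ran_dens_def)
  then obtain l' where "(\<lambda>n. mart T (hist z n)) \<longlonglongrightarrow> l'"
    by (auto simp: dens_exists_K convergent_def)
  then show "\<exists>z. (\<lambda>n. mart T (hist z n)) \<longlonglongrightarrow> l"
    using z(1) dens_K by blast
next
  assume "\<exists>z. (\<lambda>n. mart T (hist z n)) \<longlonglongrightarrow> l"
  then show "l \<in> ran_dens (K T)"
    unfolding ran_dens_def using dens_K dens_exists_K convergentI by blast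
qed

text \<open>Stop at once with the bit \<open>True\<close> at position 0, then repeat
  \<open>b\<close>. The values move monotonically, down for \<open>True\<close> and up for
  \<open>False\<close>, from a start strictly inside (0, 1), so the limit is the end they move
  towards.\<close>

lemma zero_one_in_ran_dens: "{0, 1} \<subseteq> ran_dens (K T)"
proof -
  have "of_bool (\<not> b) \<in> ran_dens (K T)" for b
  proof -
    obtain z where z: "hist z (length [True]) = [True]" "\<And>n. length [True] \<le> n \<Longrightarrow> z n = b"
      by (rule stream_extending[of "[True]" "\<lambda>_. b"]) blast
    then have z0: "z 0" and zS: "z (Suc n) = b" for n by auto
    define p where "p n = mart T (hist z (Suc n))" for n
    have stop: "\<not> active T (hist z (Suc n))" for n
      by (rule stopped_mono[of T z 1]) (simp_all add: z0)
    have range: "0 \<le> p n" "p n \<le> 1" for n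
      using mart_range unfolding p_def by blast+
    have "p (Suc n) = (if b then 2 * p n - steer (p n) 1 else steer (p n) 1)" for n
    proof -
      have "hist z (Suc (Suc n)) = b # hist z (Suc n)"
        by (simp add: zS)
      then show ?thesis
        using stop[of n] unfolding p_def by (simp add: aim_def del: hist_Suc)
    qed
    then have step: "p (Suc n) = (if b then max 0 (2 * p n - 1) else min 1 (2 * p n))" for n
      using range[of n] by (auto simp: steer_def max_def min_def)
    \<comment> \<open>The starting value is \<open>1 - target [] 0\<close>.\<close>
    have p0: "0 < p 0" "p 0 < 1"
      using z0 target_range(3,4)[OF Nil_in_U, of 0] by (auto simp: p_def aim_def steer_def)
    have lim01: "of_bool (\<not> b) \<in> ran_dens (K T)"
      if l: "p \<longlonglongrightarrow> l" "if b then l \<le> p 0 else p 0 \<le> l" for l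
    proof -
      have lim: "(\<lambda>n. mart T (hist z n)) \<longlonglongrightarrow> l"
        by (rule LIMSEQ_imp_Suc) (use l(1) in \<open>simp add: p_def[abs_def] del: hist_Suc\<close>)
      then have "l \<in> {0, 1}"
        by (rule stopped_limit[OF stop])
      then have "l = of_bool (\<not> b)"
        using l(2) p0 by (cases b) auto
      then show ?thesis using lim ran_dens_K by blast
    qed
    show ?thesis
    proof (cases b)
      case True
      have "decseq p"
        by (rule decseq_SucI) (use step range in \<open>auto simp: True max_def\<close>)
      then obtain l where "p \<longlonglongrightarrow> l" "\<forall>i. l \<le> p i"
        using decseq_convergent[of p 0] range by blast
      then show ?thesis using lim01[of l] True by simp
    next
      case False
      have "incseq p"
        by (rule incseq_SucI) (use step range in \<open>auto simp: False min_def\<close>)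
      then obtain l where "p \<longlonglongrightarrow> l" "\<forall>i. p i \<le> l"
        using incseq_convergent[of p 1] range by blast
      then show ?thesis using lim01[of l] False by simp
    qed
  qed
  from this[of True] this[of False] show ?thesis by simp
qed

lemma active_steps:
  assumes act: "\<And>n. active T (hist z n)"
  shows "mart T (hist z (Suc (2 * i))) =
      steer (mart T (hist z (2 * i))) (target (second_part (hist z (2 * i))) i)"
    and "mart T (hist z (2 * Suc i)) = mart T (hist z (Suc (2 * i)))"
proof -
  have "\<not> z (2 * i)" using act[of "Suc (2 * i)"] by simp
  then show "mart T (hist z (Suc (2 * i))) =
      steer (mart T (hist z (2 * i))) (target (second_part (hist z (2 * i))) i)"
    using act[of "2 * i"] by (simp add: aim_def)
  let ?r = "hist z (Suc (2 * i))"
  have "hist z (2 * Suc i) = z (Suc (2 * i)) # ?r" by simp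
  moreover have "aim T ?r (mart T ?r) = mart T ?r"
    using act[of "Suc (2 * i)"] by (simp add: aim_def del: hist_Suc active.simps mart.simps)
  moreover have "steer (mart T ?r) (mart T ?r) = mart T ?r"
    using mart_range[of T ?r] by (intro steer_self) auto
  ultimately show "mart T (hist z (2 * Suc i)) = mart T ?r"
    by (simp del: hist_Suc mult_Suc_right)
qed

text \<open>Rounding \<open>n\<close> up to an even index costs nothing, since odd positions leave
  the value unchanged; limits along even indices thus carry over to all indices.\<close>

lemma mart_active_eq:
  assumes act: "\<And>n. active T (hist z n)"
  shows "mart T (hist z n) = mart T (hist z (2 * (Suc n div 2)))"
proof (cases "even n")
  case True
  then show ?thesis by (auto elim!: evenE simp del: hist_Suc)
next
  case False
  then obtain i where "n = Suc (2 * i)" by (auto elim: oddE)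
  then show ?thesis using active_steps(2)[OF act, of i] by (simp del: hist_Suc mult_Suc_right)
qed

lemma length_part_mono:
  "m \<le> n \<Longrightarrow> length (second_part (hist z m)) \<le> length (second_part (hist z n))"
proof (induction rule: dec_induct)
  case (step n)
  have "length (second_part (hist z n)) \<le> length (second_part (z n # hist z n))"
    using second_part_chain[of "hist z n" "z n"] by (metis nat_le_linear take_all)
  then show ?case using step by simp
qed simp

text \<open>Once nothing more is read for \<open>U\<close>, the targets alternate forever between
  two distinct fixed values.\<close>

lemma active_bounded_divergent:
  assumes act: "\<And>n. active T (hist z n)"
    and bounded: "\<And>n. length (second_part (hist z n)) < m"
  shows "\<not> convergent (\<lambda>n. mart T (hist z n))"
proof
  let ?a = "\<lambda>i. mart T (hist z (2 * i))"
  let ?u = "\<lambda>n. second_part (hist z n)"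
  \<comment> \<open>At time \<open>N\<close> the decoded part has its greatest length; being a
    chain, it cannot change later without growing.\<close>
  obtain N where N: "\<And>n. length (?u n) \<le> length (?u N)"
    using ex_has_greatest_nat[of "\<lambda>_. True" 0 "\<lambda>n. length (?u n)" m] bounded by (auto intro: less_imp_le)
  have const: "?u n = ?u N" if "N \<le> n" for n
    using that
  proof (induction rule: dec_induct)
    case (step n)
    then show ?case
      using second_part_chain[of "hist z n" "z n"] N[of "Suc n"] by simp
  qed simp
  have U: "?u N \<in> U" using act active_in_U by blast
  have "\<not> convergent ?a"
  proof (rule steered_alternating_divergent)
    show "?a (Suc i) = steer (?a i) (target (?u (2 * i)) i)" for i
      using active_steps[OF act, of i] by (simp only:)
    show "0 < ?a i \<and> ?a i < 1" for i
      using mart_active_range act by blast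
    show "target (?u (2 * i)) i = (if even i then v (?u N) else v (?u N) + (1 - v (?u N)) / real (length (?u N) + 2))"
      if "N \<le> i" for i
      using const[of "2 * i"] that by (simp add: target_def)
  qed (use v_range[OF U] target_range[OF U] in auto)
  moreover assume "convergent (\<lambda>n. mart T (hist z n))"
  then obtain l where "(\<lambda>n. mart T (hist z n)) \<longlonglongrightarrow> l" by (auto simp: convergent_def)
  then have "?a \<longlonglongrightarrow> l"
    by (rule filterlim_compose) (rule filterlim_subseq, simp add: strict_mono_def)
  ultimately show False by (auto simp: convergent_def)
qed

text \<open>Both targets approach \<open>l\<close>: \<open>v\<close> does so along the decoded part,
  and the gap is at most the reciprocal of its length plus one. The steered values follow.\<close>

lemma active_unbounded_tendsto:
  assumes act: "\<And>n. active T (hist z n)"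
    and unbounded: "\<And>m. \<exists>n. m \<le> length (second_part (hist z n))"
    and x: "\<And>n. second_part (hist z n) = restr x (length (second_part (hist z n)))"
    and lim: "(\<lambda>m. v (restr x m)) \<longlonglongrightarrow> l"
  shows "(\<lambda>n. mart T (hist z n)) \<longlonglongrightarrow> l"
proof -
  let ?a = "\<lambda>i. mart T (hist z (2 * i))"
  let ?u = "\<lambda>n. second_part (hist z n)"
  have len: "filterlim (\<lambda>i. length (?u (2 * i))) at_top sequentially"
    unfolding filterlim_at_top
  proof
    fix m
    obtain n where n: "m \<le> length (?u n)" using unbounded by blast
    show "\<forall>\<^sub>F i in sequentially. m \<le> length (?u (2 * i))"
    proof (rule eventually_sequentiallyI[of n])
      fix i assume "n \<le> i"
      then show "m \<le> length (?u (2 * i))"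
        using n length_part_mono[of n "2 * i" z] by linarith
    qed
  qed
  have v_lim: "(\<lambda>i. v (?u (2 * i))) \<longlonglongrightarrow> l"
    using filterlim_compose[OF lim len] x[symmetric] by simp
  have "(\<lambda>i. target (?u (2 * i)) i - v (?u (2 * i))) \<longlonglongrightarrow> 0"
  proof (rule Lim_null_comparison)
    show "\<forall>\<^sub>F i in sequentially. norm (target (?u (2 * i)) i - v (?u (2 * i)))
        \<le> inverse (real (Suc (length (?u (2 * i)))))"
    proof (rule always_eventually, rule allI)
      fix i
      let ?w = "?u (2 * i)"
      have "0 < v ?w" "v ?w < 1" using v_range[OF active_in_U[OF act[of "2 * i"]]] by auto
      then have "(1 - v ?w) / real (length ?w + 2) \<le> 1 / real (Suc (length ?w))"
        by (intro frac_le) auto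
      then show "norm (target ?w i - v ?w) \<le> inverse (real (Suc (length ?w)))"
        using \<open>v ?w < 1\<close> by (simp add: target_def inverse_eq_divide)
    qed
    show "(\<lambda>i. inverse (real (Suc (length (?u (2 * i)))))) \<longlonglongrightarrow> 0"
      by (rule filterlim_compose[OF LIMSEQ_inverse_real_of_nat len])
  qed
  from tendsto_add[OF this v_lim] have "(\<lambda>i. target (?u (2 * i)) i) \<longlonglongrightarrow> l"
    by simp
  then have "?a \<longlonglongrightarrow> l"
  proof (rule steered_tendsto[rotated 2])
    show "?a (Suc i) = steer (?a i) (target (?u (2 * i)) i)" for i
      using active_steps[OF act, of i] by (simp only:)
    show "0 < ?a i \<and> ?a i < 1" for i
      using mart_active_range act by blast
  qed
  moreover have "filterlim (\<lambda>n. Suc n div 2) sequentially sequentially"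
    unfolding filterlim_at_top
    by (intro allI) (rule_tac c = "2 * Z" in eventually_sequentiallyI, linarith)
  ultimately have "(\<lambda>n. ?a (Suc n div 2)) \<longlonglongrightarrow> l"
    by (rule filterlim_compose)
  then show ?thesis
    using mart_active_eq[OF act] by (simp only:)
qed

end

section \<open>Correspondence between active points and pairs of branches\<close>

lemma count_restr: "length (filter id (restr y n)) = card {i. i < n \<and> y i}"
  unfolding length_filter_conv_card by (rule arg_cong[of _ _ card]) (auto simp: restr_def)

lemma restr_Suc: "restr x (Suc n) = restr x n @ [x n]"
  by (simp add: restr_def)

context steering
begin

lemma active_unbounded_branches:
  assumes U: "pruned_tree U" and T: "T \<in> PrTr2"
    and act: "\<And>n. active T (hist z n)"
    and unbounded: "\<And>m. \<exists>n. m \<le> length (second_part (hist z n))"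
  obtains x where "x \<in> body U" "body (Collect T) \<inter> infOnes \<noteq> {}"
    "\<And>n. second_part (hist z n) = restr x (length (second_part (hist z n)))"
proof -
  let ?u = "\<lambda>n. second_part (hist z n)" and ?t = "\<lambda>n. first_part (hist z n)"
  have T': "pruned_tree (Collect T)" using T by (simp add: PrTr2_def)
  have count: "length (?u n) \<le> length (?t n)" for n
    using count_first_part[of "hist z n"] length_filter_le[of id "?t n"] by simp
  have t_unbounded: "\<exists>n. m \<le> length (?t n)" for m
    using unbounded[of m] count le_trans by blast
  obtain x where x: "\<And>n. ?u n = restr x (length (?u n))"
    by (rule branch_of_chain[of ?u]) (use unbounded second_part_chain in auto)
  obtain y where y: "\<And>n. ?t n = restr y (length (?t n))"
    by (rule branch_of_chain[of ?t]) (use t_unbounded first_part_chain in auto)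
  have "x \<in> body U"
    by (rule body_of_chain[of U ?u, OF U _ unbounded x]) (rule active_in_U[OF act])
  have "y \<in> body (Collect T)"
    by (rule body_of_chain[of "Collect T" ?t, OF T' _ t_unbounded y])
      (use active_in_T[OF act] Nil_in_pruned_tree[OF T'] in auto)
  moreover have "y \<in> infOnes"
    unfolding infOnes_def
  proof safe
    \<comment> \<open>Finitely many ones in \<open>y\<close> would bound the number of entries read
      for \<open>U\<close>.\<close>
    assume fin: "finite {n. y n}"
    obtain n where n: "Suc (card {n. y n}) \<le> length (?u n)" using unbounded by blast
    have "length (?u n) = card {i. i < length (?t n) \<and> y i}"
      using count_first_part[of "hist z n"] y[of n] count_restr[of y "length (?t n)"] by simp
    also have "\<dots> \<le> card {n. y n}"
      using fin by (intro card_mono) auto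
    finally show False using n by simp
  qed
  ultimately show thesis
    using that[OF \<open>x \<in> body U\<close> _ x] by blast
qed

text \<open>The point is written by a rule inverse to the parser: at odd positions it emits zeros
  until the counter reaches the code of the next entries, then a 1.\<close>

lemma branches_realised:
  assumes x: "x \<in> body U" and y: "y \<in> body (Collect T) \<inter> infOnes"
  obtains z where "\<And>n. active T (hist z n)"
    "\<And>m. \<exists>n. m \<le> length (second_part (hist z n))"
    "\<And>n. second_part (hist z n) = restr x (length (second_part (hist z n)))"
proof -
  \<comment> \<open>An odd code \<open>2 * x + 1\<close> announces a 1 in \<open>y\<close> and
    returns the entry of \<open>x\<close> on halving; the even code 0 announces a 0.\<close>
  define bound where "bound t u = (if y (length t) then 2 * x (length u) + 1 else 0)"
    for t :: "bool list" and u :: "nat list"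
  define g where "g h = (if even (length h) then False else
      (case parse h of (t, u, k) \<Rightarrow> bound t u \<le> k))" for h
  obtain z where z: "\<And>n. z n = g (hist z n)"
    using stream_of_rule[of g] by auto
  have step: "parse (hist z (Suc n)) = (if even n then parse (hist z n) else
      (case parse (hist z n) of (t, u, k) \<Rightarrow> feed (bound t u \<le> k) (t, u, k)))" for n
    by (cases "parse (hist z n)") (simp add: z g_def)
  \<comment> \<open>The invariant that \<open>k\<close> never exceeds the code turns the test
    \<open>bound t u \<le> k\<close> into equality, so exactly the intended code is parsed.\<close>
  have inv: "case parse (hist z n) of (t, u, k) \<Rightarrow>
      t = restr y (length t) \<and> u = restr x (length u) \<and> k \<le> bound t u" for n
  proof (induction n)
    case 0
    show ?case by (simp add: restr_def)
  next
    case (Suc n)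
    obtain t u k where tuk: "parse (hist z n) = (t, u, k)" by (cases "parse (hist z n)")
    then have IH: "t = restr y (length t)" "u = restr x (length u)" "k \<le> bound t u"
      using Suc by auto
    show ?case
    proof (cases "odd n \<and> bound t u \<le> k")
      case True
      then have k: "k = bound t u" using IH by simp
      have "parse (hist z (Suc n)) =
          (if y (length t) then (t @ [True], u @ [x (length u)], 0) else (t @ [False], u, 0))"
        using step[of n] True by (simp add: tuk k) (simp add: bound_def)
      moreover have "restr y (Suc (length t)) = t @ [y (length t)]"
        "restr x (Suc (length u)) = u @ [x (length u)]"
        using IH by (simp_all add: restr_Suc)
      ultimately show ?thesis using IH by simp
    next
      case False
      then show ?thesis using step[of n] IH tuk by auto
    qed
  qed
  have inv_t: "first_part (hist z n) = restr y (length (first_part (hist z n)))"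
    and inv_u: "second_part (hist z n) = restr x (length (second_part (hist z n)))" for n
    using inv[of n] by (auto simp: first_part_def second_part_def split: prod.splits)
  have act: "active T (hist z n)" for n
  proof (induction n)
    case (Suc n)
    have "T (first_part (hist z (Suc n)))" "second_part (hist z (Suc n)) \<in> U"
      using inv_t[of "Suc n"] inv_u[of "Suc n"] x y unfolding body_def
      by (metis Int_iff mem_Collect_eq)+
    then show ?case using Suc z[of n] by (simp add: g_def)
  qed simp
  \<comment> \<open>Induction on the number of zeros still to be written; each takes two positions,
    as the even one in between is skipped.\<close>
  have progress: "\<exists>m. length t < length (first_part (hist z m))"
    if "odd n" "parse (hist z n) = (t, u, k)" for n t u k
    using that
  proof (induction "bound t u - k" arbitrary: n k rule: less_induct)
    case less
    show ?case
    proof (cases "bound t u \<le> k")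
      case True
      then have "length t < length (first_part (hist z (Suc n)))"
        using step[of n] less.prems by (simp add: first_part_def del: hist_Suc)
      then show ?thesis by blast
    next
      case False
      then have "parse (hist z (Suc (Suc n))) = (t, u, Suc k)"
        using step[of n] step[of "Suc n"] less.prems by (simp del: hist_Suc)
      then show ?thesis
        using less.hyps[of "Suc k" "Suc (Suc n)"] False less.prems by auto
    qed
  qed
  have t_unbounded: "\<exists>n. m \<le> length (first_part (hist z n))" for m
  proof (induction m)
    case (Suc m)
    then obtain n where n: "m \<le> length (first_part (hist z n))" by blast
    \<comment> \<open>\<open>progress\<close> starts at an odd position; passing an even one does
      not change what has been parsed.\<close>
    define n' where "n' = (if odd n then n else Suc n)"
    obtain t u k where tuk: "parse (hist z n') = (t, u, k)" by (cases "parse (hist z n')")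
    have "odd n'" by (simp add: n'_def)
    have "first_part (hist z n') = first_part (hist z n)"
      using step[of n] by (simp add: n'_def first_part_def del: hist_Suc)
    then have "m \<le> length t" using n tuk by (simp add: first_part_def)
    moreover obtain l where "length t < length (first_part (hist z l))"
      using progress[OF \<open>odd n'\<close> tuk] by blast
    ultimately show ?case by (intro exI[of _ l]) simp
  qed simp
  have u_unbounded: "\<exists>n. m \<le> length (second_part (hist z n))" for m
  proof -
    have "infinite {i. y i}" using y by (simp add: infOnes_def)
    then obtain B where B: "finite B" "card B = m" "B \<subseteq> {i. y i}"
      using infinite_arbitrarily_large by blast
    obtain l where l: "\<And>i. i \<in> B \<Longrightarrow> i < l"
      using finite_nat_set_iff_bounded[of B] B(1) by auto
    obtain n where n: "l \<le> length (first_part (hist z n))"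
      using t_unbounded by blast
    have "m \<le> card {i. i < length (first_part (hist z n)) \<and> y i}"
      unfolding B(2)[symmetric]
      by (rule card_mono) (use B(3) l n in force)+
    also have "\<dots> = length (second_part (hist z n))"
      using count_first_part[of "hist z n"] inv_t[of n] count_restr by metis
    finally show ?thesis by blast
  qed
  show thesis
    by (rule that[OF act u_unbounded inv_u])
qed

text \<open>The constant \<open>False\<close> point never completes a unary number, so it stays
  active with nothing decoded and oscillates.\<close>

lemma exists_divergent:
  assumes "T []"
  shows "\<exists>z. \<not> convergent (\<lambda>n. mart T (hist z n))"
proof -
  let ?z = "\<lambda>_. False"
  have parts: "first_part (hist ?z n) = [] \<and> second_part (hist ?z n) = []" for n
  proof (induction n)
    case (Suc n)
    then show ?case
      by (cases "parse (hist ?z n)") (simp add: first_part_def second_part_def)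
  qed simp
  have "active T (hist ?z n)" for n
  proof (induction n)
    case (Suc n)
    then show ?case using parts[of "Suc n"] assms Nil_in_U by simp
  qed simp
  then have "\<not> convergent (\<lambda>n. mart T (hist ?z n))"
    by (rule active_bounded_divergent[where m = 1]) (simp add: parts)
  then show ?thesis by blast
qed

end

section \<open>Approximation of \<open>c\<close> and proof of the theorem\<close>

lemma continuous_along_branch:
  fixes c :: "(nat \<Rightarrow> nat) \<Rightarrow> real"
  assumes cont: "continuous_map (subtopology baire_top S) (subtopology euclideanreal R) c"
    and "x \<in> S" "\<And>m. b m \<in> S" "\<And>m. restr (b m) m = restr x m"
  shows "(\<lambda>m. c (b m)) \<longlonglongrightarrow> c x"
proof -
  have "limitin baire_top b x sequentially"
    unfolding baire_top_def limitin_componentwise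
  proof (intro conjI ballI)
    fix i :: nat
    \<comment> \<open>Coordinate \<open>i\<close> is settled as soon as the common initial segment
      has length \<open>Suc i\<close>.\<close>
    have "\<forall>\<^sub>F m in sequentially. b m i = x i"
      by (rule eventually_sequentiallyI[of "Suc i"]) (use assms(4) in \<open>auto simp: restr_eq_iff\<close>)
    then show "limitin (discrete_topology UNIV) (\<lambda>m. b m i) (x i) sequentially"
      by (auto simp: limitin_def elim: eventually_mono)
  qed auto
  then have "limitin (subtopology baire_top S) b x sequentially"
    using assms(2,3) by (simp add: limitin_subtopology)
  from continuous_map_limit[OF cont this] show ?thesis
    by (simp add: limitin_subtopology comp_def)
qed

theorem theorem4p3:
  fixes U :: "nat list set" and c :: "(nat \<Rightarrow> nat) \<Rightarrow> real"
  assumes "pruned_tree U"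
    and "continuous_map (subtopology baire_top (body U)) (subtopology euclideanreal {0<..<1}) c"
  shows "\<exists>H :: (bool list \<Rightarrow> bool) \<Rightarrow> (nat \<Rightarrow> bool) set.
           continuous_map PrTr2_top vietoris_top H \<and>
           (\<forall>T\<in>PrTr2. (T \<in> WF2 \<longrightarrow> spongy (H T)) \<and>
                       (T \<in> IF2 \<longrightarrow> ran_dens (H T) = c ` body U \<union> {0, 1}))"
proof -
  \<comment> \<open>Since \<open>c\<close> is controlled only on branches, each node
    \<open>u\<close> gets a branch through it, and \<open>c (b u)\<close> plays the role of
    \<open>v u\<close>.\<close>
  define b where "b u = (SOME x. x \<in> body U \<and> restr x (length u) = u)" for u
  have b: "b u \<in> body U \<and> restr (b u) (length u) = u" if u: "u \<in> U" for u
  proof -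
    obtain x where "x \<in> body U \<and> restr x (length u) = u"
      by (rule pruned_tree_branch[OF assms(1) u]) blast
    then show ?thesis unfolding b_def by (rule someI[of "\<lambda>x. x \<in> body U \<and> restr x (length u) = u"])
  qed
  have "c \<in> body U \<rightarrow> {0<..<1}"
    using assms(2) by (simp add: continuous_map_in_subtopology baire_top_def)
  then have c_range: "0 < c x \<and> c x < 1" if "x \<in> body U" for x
    using that by auto
  interpret steering U "\<lambda>u. c (b u)"
    by unfold_locales (use Nil_in_pruned_tree[OF assms(1)] b c_range in auto)
  have v_lim: "(\<lambda>m. c (b (restr x m))) \<longlonglongrightarrow> c x" if "x \<in> body U" for x
  proof (rule continuous_along_branch[OF assms(2) that])
    have "restr x m \<in> U" for m using that by (simp add: body_def)
    from b[OF this] show "b (restr x m) \<in> body U" "restr (b (restr x m)) m = restr x m" for m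
      by auto
  qed
  \<comment> \<open>If the point never stops, convergence forces unbounded decoding; this yields a
    branch of \<open>T\<close> with infinitely many ones and makes the limit a value of
    \<open>c\<close>.\<close>
  have limits: "l \<in> {0, 1} \<or> T \<in> IF2 \<and> l \<in> c ` body U"
    if T: "T \<in> PrTr2" and l: "(\<lambda>n. mart T (hist z n)) \<longlonglongrightarrow> l" for T z l
  proof (cases "\<forall>n. active T (hist z n)")
    case True
    then have act: "active T (hist z n)" for n by blast
    have unbounded: "\<exists>n. m \<le> length (second_part (hist z n))" for m
      using active_bounded_divergent[OF act, of m] l by (meson convergentI not_le)
    obtain x where x: "x \<in> body U" "body (Collect T) \<inter> infOnes \<noteq> {}"
      "\<And>n. second_part (hist z n) = restr x (length (second_part (hist z n)))"
      by (rule active_unbounded_branches[OF assms(1) T act unbounded]) blast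
    have "(\<lambda>n. mart T (hist z n)) \<longlonglongrightarrow> c x"
      by (rule active_unbounded_tendsto[OF act unbounded x(3) v_lim[OF x(1)]])
    then have "l = c x" using l LIMSEQ_unique by blast
    then show ?thesis using x T by (auto simp: IF2_def)
  next
    case False
    then show ?thesis using stopped_limit l by blast
  qed
  have "spongy (K T)" if T: "T \<in> WF2" for T
    unfolding spongy_def
  proof (intro conjI allI impI)
    have T': "T \<in> PrTr2" "T \<notin> IF2" using T by (auto simp: WF2_def IF2_def)
    then have "T []"
      using Nil_in_pruned_tree[of "Collect T"] by (simp add: PrTr2_def)
    then show "\<exists>z. \<not> dens_exists (K T) z"
      using exists_divergent dens_exists_K by blast
    fix z assume "dens_exists (K T) z"
    then obtain l where l: "(\<lambda>n. mart T (hist z n)) \<longlonglongrightarrow> l"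
      by (auto simp: dens_exists_K convergent_def)
    then show "dens (K T) z \<in> {0, 1}"
      using limits[OF T'(1) l] T'(2) dens_K[OF l] by simp
  qed
  moreover have "ran_dens (K T) = c ` body U \<union> {0, 1}" if T: "T \<in> IF2" for T
  proof
    have "T \<in> PrTr2" using T by (simp add: IF2_def)
    then show "ran_dens (K T) \<subseteq> c ` body U \<union> {0, 1}"
      using limits ran_dens_K by blast
    \<comment> \<open>A single such \<open>y\<close> serves for all \<open>x\<close>, since every
      entry of \<open>x\<close> can be attached to the ones of \<open>y\<close>.\<close>
    obtain y where y: "y \<in> body (Collect T) \<inter> infOnes"
      using T by (auto simp: IF2_def)
    have "c x \<in> ran_dens (K T)" if x: "x \<in> body U" for x
    proof -
      obtain z where z: "\<And>n. active T (hist z n)"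
          "\<And>m. \<exists>n. m \<le> length (second_part (hist z n))"
          "\<And>n. second_part (hist z n) = restr x (length (second_part (hist z n)))"
        by (rule branches_realised[OF x y]) blast
      show ?thesis
        using active_unbounded_tendsto[OF z v_lim[OF x]] ran_dens_K by blast
    qed
    then show "c ` body U \<union> {0, 1} \<subseteq> ran_dens (K T)"
      using zero_one_in_ran_dens[of T] by blast
  qed
  ultimately show ?thesis
    using continuous_K by blast
qed

end
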